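(* Let $A,B,C$ be a Leonard triple on $V$ that has $q$-Racah type with Huang data $(a,b,c,d)$, let $W,W',W''\in\mathrm{End}(V)$ be as defined in the context, and write $[X,Y]=XY-YX$. Then: Conjugation by $W^{\pm2}$: $W^{-2}AW^2=A$, $\;W^{-2}BW^2=B+\frac{[C,A]}{q-q^{-1}}$, $\;W^{-2}CW^2=C-\frac{[A,B]}{q-q^{-1}}+\frac{[A,[A,C]]}{(q-q^{-1})^2}$; and $W^2AW^{-2}=A$, $\;W^2BW^{-2}=B-\frac{[C,A]}{q-q^{-1}}+\frac{[A,[A,B]]}{(q-q^{-1})^2}$, $\;W^2CW^{-2}=C+\frac{[A,B]}{q-q^{-1}}$. Conjugation by $(W')^{\pm2}$: $(W')^{-2}A(W')^2=A-\frac{[B,C]}{q-q^{-1}}+\frac{[B,[B,A]]}{(q-q^{-1})^2}$, $\;(W')^{-2}B(W')^2=B$, $\;(W')^{-2}C(W')^2=C+\frac{[A,B]}{q-q^{-1}}$; and $(W')^2A(W')^{-2}=A+\frac{[B,C]}{q-q^{-1}}$, $\;(W')^2B(W')^{-2}=B$, $\;(W')^2C(W')^{-2}=C-\frac{[A,B]}{q-q^{-1}}+\frac{[B,[B,C]]}{(q-q^{-1})^2}$. Conjugation by $(W'')^{\pm2}$: $(W'')^{-2}A(W'')^2=A+\frac{[B,C]}{q-q^{-1}}$, $\;(W'')^{-2}B(W'')^2=B-\frac{[C,A]}{q-q^{-1}}+\frac{[C,[C,B]]}{(q-q^{-1})^2}$, $\;(W'')^{-2}C(W'')^2=C$; and $(W'')^2A(W'')^{-2}=A-\frac{[B,C]}{q-q^{-1}}+\frac{[C,[C,A]]}{(q-q^{-1})^2}$,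 $\;(W'')^2B(W'')^{-2}=B+\frac{[C,A]}{q-q^{-1}}$, $\;(W'')^2C(W'')^{-2}=C$.
   Context: Let $\mathbb F$ be a field, $d\ge 0$ an integer, $V$ a vector space over $\mathbb F$ of dimension $d+1$, $\mathrm{End}(V)$ the $\mathbb F$-algebra of $\mathbb F$-linear maps $V\to V$, and $I$ its identity. A square matrix is tridiagonal if each nonzero entry lies on the diagonal, subdiagonal or superdiagonal; a tridiagonal matrix is irreducible if every subdiagonal entry and every superdiagonal entry is nonzero. Leonard triple on $V$: a 3-tuple $A,B,C$ of elements of $\mathrm{End}(V)$ such that (i) there is a basis of $V$ with respect to which $A$ is represented by a diagonal matrix and $B,C$ by irreducible tridiagonal matrices; (ii) there is a basis with respect to which $B$ is diagonal and $C,A$ are irreducible tridiagonal; (iii) there is a basis with respect to which $C$ is diagonal and $A,B$ are irreducible tridiagonal. Each of $A,B,C$ is then diagonalizable with one-dimensional eigenspaces. An ordering of the eigenvalues of $A$ is standard if corresponding eigenvectors, in that order, form a basis as in (i); similarly for $B$ with (ii) and $C$ with (iii). Standing assumptions: fix a nonzero $q\in\mathbb F$ with $q^4\ne 1$ and nonzero $a,b,c\in\mathbb F$ such that $q^{2i}\ne 1$ for $1\le i\le d$; none of $a^2,b^2,c^2$ is among $q^{2d-2},q^{2d-4},\ldots,q^{2-2d}$; none of $abc,a^{-1}bc,ab^{-1}c,abc^{-1}$ is among $q^{d-1},q^{d-3},\ldots,q^{1-d}$. For $0\le i\le d$ let $\theta_i=aq^{2i-d}+a^{-1}q^{d-2i}$,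 $\theta'_i=bq^{2i-d}+b^{-1}q^{d-2i}$, $\theta''_i=cq^{2i-d}+c^{-1}q^{d-2i}$. A Leonard triple $A,B,C$ on $V$ has $q$-Racah type with Huang data $(a,b,c,d)$ if $\{\theta_i\}_{i=0}^d$, $\{\theta'_i\}_{i=0}^d$, $\{\theta''_i\}_{i=0}^d$ are standard orderings of the eigenvalues of $A$, $B$, $C$ respectively, and $$A+\frac{qBC-q^{-1}CB}{q^2-q^{-2}}=\alpha_a I,\quad B+\frac{qCA-q^{-1}AC}{q^2-q^{-2}}=\alpha_b I,\quad C+\frac{qAB-q^{-1}BA}{q^2-q^{-2}}=\alpha_c I,$$ where $\alpha_a=\frac{(a+a^{-1})(q^{d+1}+q^{-d-1})+(b+b^{-1})(c+c^{-1})}{q+q^{-1}}$, $\alpha_b=\frac{(b+b^{-1})(q^{d+1}+q^{-d-1})+(c+c^{-1})(a+a^{-1})}{q+q^{-1}}$, $\alpha_c=\frac{(c+c^{-1})(q^{d+1}+q^{-d-1})+(a+a^{-1})(b+b^{-1})}{q+q^{-1}}$. For $0\le i\le d$ let $E_i$ (resp. $E'_i$, $E''_i$) be the primitive idempotent of $A$ (resp. $B$, $C$) for $\theta_i$ (resp. $\theta'_i$, $\theta''_i$): the projection of $V$ onto that eigenspace that is zero on the other eigenspaces. Define $$W=\sum_{i=0}^d(-1)^ia^{-i}q^{i(d-i)}E_i,\quad W'=\sum_{i=0}^d(-1)^ib^{-i}q^{i(d-i)}E'_i,\quad W''=\sum_{i=0}^d(-1)^ic^{-i}q^{i(d-i)}E''_i,$$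 which are invertible. *)

theory Defs
  imports "HOL.Vector_Spaces"
begin

text \<open>
  The vector space V is a whole type carrying a scalar multiplication (locale
  \<^locale>\<open>vector_space\<close>), and End(V) consists of the maps satisfying
  \<^const>\<open>Vector_Spaces.linear\<close>.  Matrices of size d + 1 are functions of two
  indices, of which only the entries with both indices at most d matter.
\<close>

definition diagonal_matrix :: "nat \<Rightarrow> (nat \<Rightarrow> nat \<Rightarrow> 'a::zero) \<Rightarrow> bool" where
  "diagonal_matrix d M \<longleftrightarrow> (\<forall>i\<le>d. \<forall>j\<le>d. i \<noteq> j \<longrightarrow> M i j = 0)"

definition tridiagonal_matrix :: "nat \<Rightarrow> (nat \<Rightarrow> nat \<Rightarrow> 'a::zero) \<Rightarrow> bool" where
  "tridiagonal_matrix d M \<longleftrightarrow>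
     (\<forall>i\<le>d. \<forall>j\<le>d. M i j \<noteq> 0 \<longrightarrow> i = j \<or> i = Suc j \<or> j = Suc i)"

definition irred_tridiagonal_matrix :: "nat \<Rightarrow> (nat \<Rightarrow> nat \<Rightarrow> 'a::zero) \<Rightarrow> bool" where
  "irred_tridiagonal_matrix d M \<longleftrightarrow>
     tridiagonal_matrix d M \<and> (\<forall>i<d. M (Suc i) i \<noteq> 0 \<and> M i (Suc i) \<noteq> 0)"

definition commutator :: "('v \<Rightarrow> 'v) \<Rightarrow> ('v \<Rightarrow> 'v) \<Rightarrow> 'v \<Rightarrow> 'v::ab_group_add" where
  "commutator X Y = (\<lambda>v. X (Y v) - Y (X v))"

text \<open>
  The forbidden values of the squares are the powers of q with even exponents from
  2 - 2d to 2d - 2, and those of the products are the powers with exponents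
  d - 1, d - 3, ..., 1 - d.  Both lists are empty for d = 0.
\<close>

definition huang_parameters :: "'a::field \<Rightarrow> 'a \<Rightarrow> 'a \<Rightarrow> 'a \<Rightarrow> nat \<Rightarrow> bool" where
  "huang_parameters q a b c d \<longleftrightarrow>
     q \<noteq> 0 \<and> q ^ 4 \<noteq> 1 \<and> a \<noteq> 0 \<and> b \<noteq> 0 \<and> c \<noteq> 0 \<and>
     (\<forall>i. 1 \<le> i \<and> i \<le> d \<longrightarrow> q ^ (2 * i) \<noteq> 1) \<and>
     (\<forall>k::int. 1 - int d \<le> k \<and> k \<le> int d - 1 \<longrightarrow>
        a ^ 2 \<noteq> q powi (2 * k) \<and> b ^ 2 \<noteq> q powi (2 * k) \<and> c ^ 2 \<noteq> q powi (2 * k)) \<and>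
     (\<forall>i. 1 \<le> i \<and> i \<le> d \<longrightarrow>
        a * b * c \<noteq> q powi (int d + 1 - 2 * int i) \<and>
        inverse a * b * c \<noteq> q powi (int d + 1 - 2 * int i) \<and>
        a * inverse b * c \<noteq> q powi (int d + 1 - 2 * int i) \<and>
        a * b * inverse c \<noteq> q powi (int d + 1 - 2 * int i))"

definition huang_theta :: "'a::field \<Rightarrow> nat \<Rightarrow> 'a \<Rightarrow> nat \<Rightarrow> 'a" where
  "huang_theta q d a i =
     a * q powi (2 * int i - int d) + inverse a * q powi (int d - 2 * int i)"

text \<open>
  The scalar for a; those for b and c arise by permuting the arguments cyclically.
\<close>

definition huang_alpha :: "'a::field \<Rightarrow> nat \<Rightarrow> 'a \<Rightarrow> 'a \<Rightarrow> 'a \<Rightarrow> 'a" where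
  "huang_alpha q d a b c =
     ((a + inverse a) * (q powi (int d + 1) + q powi (- int d - 1))
       + (b + inverse b) * (c + inverse c)) / (q + inverse q)"

context vector_space
begin

definition ordered_basis :: "nat \<Rightarrow> (nat \<Rightarrow> 'b) \<Rightarrow> bool" where
  "ordered_basis d u \<longleftrightarrow>
     inj_on u {..d} \<and> independent (u ` {..d}) \<and> span (u ` {..d}) = UNIV"

text \<open>Column j holds the coordinates of the image of the j-th basis vector.\<close>

definition matrix_wrt :: "nat \<Rightarrow> (nat \<Rightarrow> 'b) \<Rightarrow> ('b \<Rightarrow> 'b) \<Rightarrow> nat \<Rightarrow> nat \<Rightarrow> 'a" where
  "matrix_wrt d u X i j = representation (u ` {..d}) (X (u j)) (u i)"

definition leonard_basis ::
    "nat \<Rightarrow> (nat \<Rightarrow> 'b) \<Rightarrow> ('b \<Rightarrow> 'b) \<Rightarrow> ('b \<Rightarrow> 'b) \<Rightarrow> ('b \<Rightarrow> 'b) \<Rightarrow> bool" where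
  "leonard_basis d u A B C \<longleftrightarrow>
     ordered_basis d u \<and>
     diagonal_matrix d (matrix_wrt d u A) \<and>
     irred_tridiagonal_matrix d (matrix_wrt d u B) \<and>
     irred_tridiagonal_matrix d (matrix_wrt d u C)"

definition leonard_triple ::
    "nat \<Rightarrow> ('b \<Rightarrow> 'b) \<Rightarrow> ('b \<Rightarrow> 'b) \<Rightarrow> ('b \<Rightarrow> 'b) \<Rightarrow> bool" where
  "leonard_triple d A B C \<longleftrightarrow>
     Vector_Spaces.linear scale scale A \<and>
     Vector_Spaces.linear scale scale B \<and>
     Vector_Spaces.linear scale scale C \<and>
     (\<exists>u. leonard_basis d u A B C) \<and>
     (\<exists>u. leonard_basis d u B C A) \<and>
     (\<exists>u. leonard_basis d u C A B)"

definition eigenspace :: "('b \<Rightarrow> 'b) \<Rightarrow> 'a \<Rightarrow> 'b set" where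
  "eigenspace X \<mu> = {v. X v = \<mu> *s v}"

definition eigenvalues :: "('b \<Rightarrow> 'b) \<Rightarrow> 'a set" where
  "eigenvalues X = {\<mu>. \<exists>v. v \<noteq> 0 \<and> v \<in> eigenspace X \<mu>}"

text \<open>Standard orderings of the eigenvalues of the first of the three maps.\<close>

definition standard_ordering ::
    "nat \<Rightarrow> (nat \<Rightarrow> 'a) \<Rightarrow> ('b \<Rightarrow> 'b) \<Rightarrow> ('b \<Rightarrow> 'b) \<Rightarrow> ('b \<Rightarrow> 'b) \<Rightarrow> bool" where
  "standard_ordering d \<theta> A B C \<longleftrightarrow>
     bij_betw \<theta> {..d} (eigenvalues A) \<and>
     (\<exists>u. (\<forall>i\<le>d. u i \<in> eigenspace A (\<theta> i)) \<and> leonard_basis d u A B C)"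

definition askey_wilson_relation ::
    "'a \<Rightarrow> 'a \<Rightarrow> ('b \<Rightarrow> 'b) \<Rightarrow> ('b \<Rightarrow> 'b) \<Rightarrow> ('b \<Rightarrow> 'b) \<Rightarrow> bool" where
  "askey_wilson_relation q \<alpha> A B C \<longleftrightarrow>
     (\<forall>v. A v + (1 / (q ^ 2 - inverse q ^ 2)) *s (q *s B (C v) - inverse q *s C (B v))
            = \<alpha> *s v)"

definition q_racah_leonard_triple ::
    "'a \<Rightarrow> 'a \<Rightarrow> 'a \<Rightarrow> 'a \<Rightarrow> nat \<Rightarrow> ('b \<Rightarrow> 'b) \<Rightarrow> ('b \<Rightarrow> 'b) \<Rightarrow> ('b \<Rightarrow> 'b) \<Rightarrow> bool" where
  "q_racah_leonard_triple q a b c d A B C \<longleftrightarrow>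
     leonard_triple d A B C \<and>
     standard_ordering d (huang_theta q d a) A B C \<and>
     standard_ordering d (huang_theta q d b) B C A \<and>
     standard_ordering d (huang_theta q d c) C A B \<and>
     askey_wilson_relation q (huang_alpha q d a b c) A B C \<and>
     askey_wilson_relation q (huang_alpha q d b c a) B C A \<and>
     askey_wilson_relation q (huang_alpha q d c a b) C A B"

definition is_primitive_idempotent :: "('b \<Rightarrow> 'b) \<Rightarrow> 'a \<Rightarrow> ('b \<Rightarrow> 'b) \<Rightarrow> bool" where
  "is_primitive_idempotent X \<mu> E \<longleftrightarrow>
     Vector_Spaces.linear scale scale E \<and>
     range E = eigenspace X \<mu> \<and>
     (\<forall>v\<in>eigenspace X \<mu>. E v = v) \<and>
     (\<forall>\<nu>. \<nu> \<noteq> \<mu> \<longrightarrow> (\<forall>v\<in>eigenspace X \<nu>. E v = 0))"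

definition primitive_idempotent :: "('b \<Rightarrow> 'b) \<Rightarrow> 'a \<Rightarrow> 'b \<Rightarrow> 'b" where
  "primitive_idempotent X \<mu> = (THE E. is_primitive_idempotent X \<mu> E)"

definition W_map :: "'a \<Rightarrow> 'a \<Rightarrow> nat \<Rightarrow> ('b \<Rightarrow> 'b) \<Rightarrow> 'b \<Rightarrow> 'b" where
  "W_map q a d A = (\<lambda>v. \<Sum>i\<le>d.
     ((- 1) ^ i * a powi (- int i) * q ^ (i * (d - i)))
       *s primitive_idempotent A (huang_theta q d a i) v)"

text \<open>
  The definite description above and the functional inverse of \<^const>\<open>W_map\<close> are
  meaningful for the maps of a q-Racah triple.
\<close>

lemma eigenbasis_coordinates:
  assumes X: "Vector_Spaces.linear scale scale X"
    and u: "ordered_basis d u" and eig: "\<forall>i\<le>d. u i \<in> eigenspace X (\<theta> i)"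
    and w: "w \<in> eigenspace X \<mu>" and j: "j \<le> d" "\<theta> j \<noteq> \<mu>"
  shows "representation (u ` {..d}) w (u j) = 0"
proof -
  interpret X: Vector_Spaces.linear scale scale X by fact
  let ?B = "u ` {..d}"
  let ?r = "\<lambda>i. representation ?B w (u i)"
  have B: "independent ?B" "span ?B = UNIV" "inj_on u {..d}"
    using u by (auto simp: ordered_basis_def)
  have ex: "(\<Sum>i\<le>d. representation ?B x (u i) *s u i) = x" for x
    using sum_representation_eq[of ?B x ?B] B by (simp add: sum.reindex)
  have "(\<Sum>i\<le>d. (?r i * \<theta> i) *s u i) = X (\<Sum>i\<le>d. ?r i *s u i)"
    using eig by (simp add: X.sum X.scale eigenspace_def)
  also have "\<dots> = \<mu> *s (\<Sum>i\<le>d. ?r i *s u i)"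
    using w by (simp add: ex eigenspace_def)
  also have "\<dots> = (\<Sum>i\<le>d. (\<mu> * ?r i) *s u i)"
    by (simp add: scale_sum_right)
  finally have "(\<Sum>i\<le>d. (?r i * \<theta> i - \<mu> * ?r i) *s u i) = 0"
    by (simp add: scale_left_diff_distrib sum_subtractf)
  then have "(\<Sum>b\<in>?B. (?r (the_inv_into {..d} u b) * \<theta> (the_inv_into {..d} u b)
      - \<mu> * ?r (the_inv_into {..d} u b)) *s b) = 0"
    using B(3) by (simp add: sum.reindex the_inv_into_f_f)
  then have "?r (the_inv_into {..d} u (u j)) * \<theta> (the_inv_into {..d} u (u j))
      - \<mu> * ?r (the_inv_into {..d} u (u j)) = 0"
    using j(1) by (intro independentD[OF B(1) _ subset_refl]) auto
  then have "?r j * \<theta> j - \<mu> * ?r j = 0"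
    using j(1) B(3) by (simp add: the_inv_into_f_f)
  then have "?r j * (\<theta> j - \<mu>) = 0" by (simp add: algebra_simps)
  then show ?thesis using j(2) by simp
qed

lemma primitive_idempotent_eq:
  assumes X: "Vector_Spaces.linear scale scale X"
    and u: "ordered_basis d u" and eig: "\<forall>i\<le>d. u i \<in> eigenspace X (\<theta> i)"
    and inj: "inj_on \<theta> {..d}" and i: "i \<le> d"
  shows "is_primitive_idempotent X (\<theta> i) E \<longleftrightarrow>
           E = (\<lambda>v. representation (u ` {..d}) v (u i) *s u i)" (is "_ \<longleftrightarrow> E = ?E")
proof -
  let ?B = "u ` {..d}"
  interpret X: Vector_Spaces.linear scale scale X by fact
  interpret P: vector_space_pair scale scale ..
  have B: "independent ?B" "span ?B = UNIV" "inj_on u {..d}"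
    using u by (auto simp: ordered_basis_def)
  have ex: "(\<Sum>i\<le>d. representation ?B x (u i) *s u i) = x" for x
    using sum_representation_eq[of ?B x ?B] B by (simp add: sum.reindex)
  have lin: "Vector_Spaces.linear scale scale ?E"
    using B vector_space_axioms
    by (simp add: linear_iff representation_add representation_scale scale_left_distrib)
  have self: "?E v = v" if "v \<in> eigenspace X (\<theta> i)" for v
  proof -
    have "representation ?B v (u j) *s u j = (if j = i then ?E v else 0)" if "j \<le> d" for j
      using that eigenbasis_coordinates[OF X u eig \<open>v \<in> _\<close> that] inj i
      by (auto simp: inj_on_def)
    then have "v = (\<Sum>j\<le>d. if j = i then ?E v else 0)"
      using ex[of v] by simp
    then show ?thesis using i by simp
  qed
  have "is_primitive_idempotent X (\<theta> i) ?E"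
  proof -
    have "?E v \<in> eigenspace X (\<theta> i)" for v
      using eig i by (simp add: eigenspace_def X.scale mult.commute)
    then have "range ?E = eigenspace X (\<theta> i)"
      using self by (metis (no_types, lifting) image_subset_iff rangeI subsetI subset_antisym)
    moreover have "?E v = 0" if "\<nu> \<noteq> \<theta> i" "v \<in> eigenspace X \<nu>" for \<nu> v
      using eigenbasis_coordinates[OF X u eig that(2) i] that(1) by auto
    ultimately show ?thesis
      using lin self by (simp add: is_primitive_idempotent_def)
  qed
  moreover have "E = ?E" if E: "is_primitive_idempotent X (\<theta> i) E"
  proof
    fix v
    have "E w = ?E w" if "w \<in> ?B" for w
    proof -
      obtain j where j: "j \<le> d" "w = u j" using \<open>w \<in> ?B\<close> by auto
      show ?thesis
      proof (cases "j = i")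
        case True
        then show ?thesis
          using E eig j self unfolding is_primitive_idempotent_def by auto
      next
        case False
        then have "\<theta> j \<noteq> \<theta> i" using inj i j by (auto simp: inj_on_def)
        then have "E w = 0" "?E w = 0"
          using E \<open>is_primitive_idempotent X (\<theta> i) ?E\<close> eig j
          unfolding is_primitive_idempotent_def by blast+
        then show ?thesis by simp
      qed
    qed
    then show "E v = ?E v"
      using P.linear_eq_on_span[of E ?E ?B v] E lin B(2)
      by (auto simp: is_primitive_idempotent_def)
  qed
  ultimately show ?thesis by blast
qed

lemma is_primitive_idempotent_primitive_idempotent:
  assumes "Vector_Spaces.linear scale scale A" and "standard_ordering d \<theta> A B C" and "i \<le> d"
  shows "is_primitive_idempotent A (\<theta> i) (primitive_idempotent A (\<theta> i))"
proof -
  obtain u where "ordered_basis d u" "\<forall>i\<le>d. u i \<in> eigenspace A (\<theta> i)"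
    using assms(2) by (auto simp: standard_ordering_def leonard_basis_def)
  moreover have "inj_on \<theta> {..d}"
    using assms(2) by (simp add: standard_ordering_def bij_betw_def)
  ultimately have "\<exists>!E. is_primitive_idempotent A (\<theta> i) E"
    using primitive_idempotent_eq[OF assms(1) _ _ _ assms(3)] by simp
  then show ?thesis
    unfolding primitive_idempotent_def by (rule theI')
qed

lemma bij_W_map:
  assumes A: "Vector_Spaces.linear scale scale A"
    and std: "standard_ordering d (huang_theta q d a) A B C"
    and nz: "q \<noteq> 0" "a \<noteq> 0"
  shows "bij (W_map q a d A)"
proof -
  let ?t = "\<lambda>i. (- 1) ^ i * a powi (- int i) * q ^ (i * (d - i))"
  obtain u where u: "ordered_basis d u" "\<forall>i\<le>d. u i \<in> eigenspace A (huang_theta q d a i)"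
    using std by (auto simp: standard_ordering_def leonard_basis_def)
  have inj: "inj_on (huang_theta q d a) {..d}"
    using std by (simp add: standard_ordering_def bij_betw_def)
  let ?B = "u ` {..d}"
  have B: "independent ?B" "span ?B = UNIV" "inj_on u {..d}"
    using u by (auto simp: ordered_basis_def)
  have ex: "(\<Sum>i\<le>d. representation ?B x (u i) *s u i) = x" for x
    using sum_representation_eq[of ?B x ?B] B by (simp add: sum.reindex)
  define D where "D t v = (\<Sum>i\<le>d. (t i * representation ?B v (u i)) *s u i)" for t v
  have "primitive_idempotent A (huang_theta q d a i)
      = (\<lambda>v. representation ?B v (u i) *s u i)" if "i \<le> d" for i
    unfolding primitive_idempotent_def primitive_idempotent_eq[OF A u inj that]
    by (rule the_eq_trivial)
  then have W: "W_map q a d A = D ?t"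
    by (auto simp: W_map_def D_def intro!: sum.cong ext)
  have rep: "representation ?B (D t v) (u j) = t j * representation ?B v (u j)"
    if "j \<le> d" for t v j
  proof -
    have "representation ?B (D t v) (u j)
        = (\<Sum>i\<le>d. t i * representation ?B v (u i) * (if u j = u i then 1 else 0))"
      unfolding D_def using B
      by (simp add: representation_sum representation_scale representation_basis)
    also have "\<dots> = (\<Sum>i\<le>d. if i = j then t j * representation ?B v (u j) else 0)"
      using that B(3) by (intro sum.cong) (auto simp: inj_on_def)
    finally show ?thesis using that by simp
  qed
  have comp: "D s (D t v) = v" if "\<forall>i\<le>d. s i * t i = 1" for s t v
  proof -
    have "D s (D t v) = (\<Sum>i\<le>d. (s i * t i * representation ?B v (u i)) *s u i)"
      unfolding D_def[of s] by (intro sum.cong) (auto simp: rep mult.assoc)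
    also have "\<dots> = v" using that ex[of v] by simp
    finally show ?thesis .
  qed
  define t where "t = ?t"
  have "t i \<noteq> 0" for i using nz by (simp add: t_def)
  then have "D t (D (\<lambda>i. inverse (t i)) v) = v"
    and "D (\<lambda>i. inverse (t i)) (D t v) = v" for v
    by (auto intro!: comp)
  then show ?thesis
    unfolding W t_def[symmetric] by (intro o_bij[of "D (\<lambda>i. inverse (t i))"]) auto
qed

end

end

theory Submission
  imports Defs
begin

text \<open>
  In a basis of eigenvectors of \<open>A\<close> for the standard ordering \<open>\<theta>\<close>, the map \<open>W\<close> is diagonal,
  with entries \<open>t\<close> say, and \<open>B\<close>, \<open>C\<close> are tridiagonal.  Conjugating \<open>X\<close> to the product of
  the inverse of \<open>W\<close>, \<open>X\<close> and \<open>W\<close>, and taking the commutator of \<open>A\<close> with \<open>X\<close>, both act on the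
  matrix of \<open>X\<close> entry by entry: at position \<open>(i, j)\<close> the former multiplies by \<open>t j / t i\<close> and the
  latter by \<open>\<theta> i - \<theta> j\<close>.  So each identity is a scalar identity at every position.  Both sides
  have the same diagonal, both vanish at distance at least two from it, and only neighbouring
  indices remain.

  For neighbours \<open>i\<close>, \<open>j\<close> everything is a function of one number, the \<open>y\<close> such that
  \<open>\<theta> i = y / q + q / y\<close> and \<open>\<theta> j = y q + 1 / (y q)\<close>.  The weights in \<open>W\<close> are chosen such that
  \<open>t j / t i = - 1 / y\<close> (lemma \<open>neighbour_parameter\<close>); the eigenvalues satisfy
  \<open>\<theta> i - \<theta> j = (q - 1 / q) (1 / y - y)\<close>; and the relation that expresses \<open>C\<close> by \<open>A\<close> and \<open>B\<close>
  says that \<open>C i j = - B i j / y\<close>, because \<open>q \<theta> i - \<theta> j / q = (q\<^sup>2 - 1 / q\<^sup>2) / y\<close>.  The claims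
  about \<open>B\<close> become \<open>1 / y\<^sup>2 = 1 - (y - 1 / y) / y\<close> and
  \<open>y\<^sup>2 = 1 + (y - 1 / y) / y + (1 / y - y)\<^sup>2\<close>, and those about \<open>C\<close> are the same after
  exchanging \<open>y\<close> with \<open>1 / y\<close> (lemma \<open>conjugation_by_W_squared\<close>).

  The definition of a q-Racah triple is invariant under cyclic shifts of \<open>(A, a)\<close>, \<open>(B, b)\<close>,
  \<open>(C, c)\<close>, which turns \<open>W\<close> into \<open>W'\<close> and \<open>W''\<close>.
\<close>

section \<open>The scalars at neighbouring positions\<close>

definition W_weight :: "'a::field \<Rightarrow> 'a \<Rightarrow> nat \<Rightarrow> nat \<Rightarrow> 'a" where
  "W_weight q a d i = (- 1) ^ i * a powi (- int i) * q ^ (i * (d - i))"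

lemma W_weight_nonzero: "q \<noteq> 0 \<Longrightarrow> a \<noteq> 0 \<Longrightarrow> W_weight q a d i \<noteq> 0"
  by (simp add: W_weight_def)

lemma W_weight_Suc:
  assumes "q \<noteq> 0" "a \<noteq> 0" "i < d"
  shows "W_weight q a d (Suc i)
    = - W_weight q a d i / (a * q powi (2 * int i + 1 - int d))"
proof -
  obtain k where d: "d = Suc (i + k)"
    using assms(3) less_iff_Suc_add by blast
  have "q powi (2 * int i + 1 - int d) = q ^ i / q ^ k"
    using assms(1) by (simp add: d power_int_diff flip: power_int_of_nat)
  moreover have "W_weight q a d i = (- 1) ^ i * q ^ (i * Suc k) / a ^ i"
    by (simp add: W_weight_def d power_int_minus divide_inverse)
  moreover have "W_weight q a d (Suc i) = - ((- 1) ^ i * q ^ (Suc i * k) / a ^ Suc i)"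
    unfolding W_weight_def power_int_minus power_int_of_nat by (simp add: d divide_inverse)
  ultimately show ?thesis
    using assms(1,2) by (simp only:) (simp add: field_simps power_add)
qed

text \<open>
  The parameter \<open>y\<close> serves both directions: exchanging \<open>i\<close> and \<open>j\<close> amounts to replacing \<open>y\<close> by
  \<open>1 / y\<close>, so upper and lower neighbours can be treated alike.
\<close>

lemma neighbour_parameter:
  assumes nz: "q \<noteq> 0" "a \<noteq> 0" and ij: "i \<le> d" "j \<le> d" "j = Suc i \<or> i = Suc j"
  obtains y where "y \<noteq> 0"
    and "huang_theta q d a i = y / q + q / y"
    and "huang_theta q d a j = y * q + 1 / (y * q)"
    and "W_weight q a d j = - W_weight q a d i / y"
proof -
  define x where "x n = a * q powi (2 * int n + 1 - int d)" for n
  have x: "x n \<noteq> 0" for n using nz by (simp add: x_def)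
  have lower: "huang_theta q d a n = x n / q + q / x n" for n
  proof -
    have "q powi (2 * int n + 1 - int d) = q * q powi (2 * int n - int d)"
      using nz power_int_add_1'[of q "2 * int n - int d"] by (simp add: algebra_simps)
    moreover have "q powi (int d - 2 * int n) = inverse (q powi (2 * int n - int d))"
      by (simp flip: power_int_minus)
    ultimately show ?thesis
      using nz by (simp add: huang_theta_def x_def field_simps)
  qed
  have upper: "huang_theta q d a (Suc n) = x n * q + 1 / (x n * q)" for n
  proof -
    have "q powi (2 * int (Suc n) - int d) = q powi (2 * int n + 1 - int d) * q"
      using nz power_int_add_1[of q "2 * int n + 1 - int d"] by (simp add: algebra_simps)
    moreover have "q powi (int d - 2 * int (Suc n)) = inverse (q powi (2 * int (Suc n) - int d))"
      by (simp flip: power_int_minus)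
    ultimately show ?thesis
      using nz by (simp add: huang_theta_def x_def field_simps)
  qed
  from ij(3) show ?thesis
  proof
    assume "j = Suc i"
    then show ?thesis
      using that[of "x i"] x lower upper W_weight_Suc[OF nz, of i d] ij by (simp add: x_def)
  next
    assume "i = Suc j"
    then show ?thesis
      using that[of "1 / x j"] x[of j] nz lower[of j] upper[of j] W_weight_Suc[OF nz, of j d] ij
      by (simp add: x_def field_simps)
  qed
qed

section \<open>Coordinates in an eigenbasis\<close>

context vector_space
begin

lemma linear_combination_of_linear_maps:
  assumes "Vector_Spaces.linear scale scale X" "Vector_Spaces.linear scale scale Y"
  shows "Vector_Spaces.linear scale scale (\<lambda>v. X v + k *s Y v)"
    and "Vector_Spaces.linear scale scale (\<lambda>v. X v - k *s Y v)"
  using assms by (simp_all add: linear_iff algebra_simps)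

lemma linear_commutator:
  assumes "Vector_Spaces.linear scale scale X" "Vector_Spaces.linear scale scale Y"
  shows "Vector_Spaces.linear scale scale (commutator X Y)"
  using assms by (simp add: linear_iff commutator_def algebra_simps)

lemma sum_representation_ordered_basis:
  assumes "ordered_basis d u"
  shows "(\<Sum>i\<le>d. representation (u ` {..d}) x (u i) *s u i) = x"
  using assms sum_representation_eq[of "u ` {..d}" x "u ` {..d}"]
  by (simp add: sum.reindex ordered_basis_def)

lemma linear_eq_if_matrix_wrt_eq:
  assumes u: "ordered_basis d u"
    and X: "Vector_Spaces.linear scale scale X" and Y: "Vector_Spaces.linear scale scale Y"
    and eq: "\<And>i j. i \<le> d \<Longrightarrow> j \<le> d \<Longrightarrow> matrix_wrt d u X i j = matrix_wrt d u Y i j"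
  shows "X = Y"
proof
  fix v
  interpret P: vector_space_pair scale scale ..
  have "X w = Y w" if w: "w \<in> u ` {..d}" for w
  proof -
    obtain j where "j \<le> d" "w = u j" using w by auto
    then have "(\<Sum>i\<le>d. representation (u ` {..d}) (X w) (u i) *s u i)
        = (\<Sum>i\<le>d. representation (u ` {..d}) (Y w) (u i) *s u i)"
      using eq[of _ j] by (intro sum.cong) (auto simp: matrix_wrt_def)
    then show ?thesis by (simp only: sum_representation_ordered_basis[OF u])
  qed
  then show "X v = Y v"
    using P.linear_eq_on_span[of X Y "u ` {..d}" v] X Y u
    by (simp add: ordered_basis_def)
qed

lemma representation_diagonal_map:
  assumes u: "ordered_basis d u" and D: "Vector_Spaces.linear scale scale D"
    and eig: "\<forall>i\<le>d. u i \<in> eigenspace D (t i)" and j: "j \<le> d"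
  shows "representation (u ` {..d}) (D v) (u j) = t j * representation (u ` {..d}) v (u j)"
proof -
  interpret D: Vector_Spaces.linear scale scale D by fact
  let ?B = "u ` {..d}"
  have B: "independent ?B" "span ?B = UNIV" "inj_on u {..d}"
    using u by (auto simp: ordered_basis_def)
  have "D v = D (\<Sum>i\<le>d. representation ?B v (u i) *s u i)"
    by (simp add: sum_representation_ordered_basis[OF u])
  also have "\<dots> = (\<Sum>i\<le>d. (representation ?B v (u i) * t i) *s u i)"
    using eig by (simp add: D.sum D.scale eigenspace_def)
  finally have "representation ?B (D v) (u j)
      = (\<Sum>i\<le>d. representation ?B v (u i) * t i * (if u j = u i then 1 else 0))"
    using B by (simp add: representation_sum representation_scale representation_basis)
  also have "\<dots> = (\<Sum>i\<le>d. if i = j then t j * representation ?B v (u j) else 0)"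
    using j B(3) by (intro sum.cong) (auto simp: inj_on_def)
  finally show ?thesis using j by simp
qed

lemma matrix_wrt_linear_combination:
  assumes "ordered_basis d u"
  shows "matrix_wrt d u (\<lambda>v. X v + k *s Y v) i j
    = matrix_wrt d u X i j + k * matrix_wrt d u Y i j"
    and "matrix_wrt d u (\<lambda>v. X v - k *s Y v) i j
    = matrix_wrt d u X i j - k * matrix_wrt d u Y i j"
  using assms
  by (simp_all add: matrix_wrt_def ordered_basis_def representation_add representation_diff
      representation_scale)

lemma matrix_wrt_diagonal_times_diagonal:
  assumes u: "ordered_basis d u" and X: "Vector_Spaces.linear scale scale X"
    and D: "Vector_Spaces.linear scale scale D" "\<forall>i\<le>d. u i \<in> eigenspace D (s i)"
    and D': "\<forall>i\<le>d. u i \<in> eigenspace D' (t i)"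
    and ij: "i \<le> d" "j \<le> d"
  shows "matrix_wrt d u (D \<circ> X \<circ> D') i j = s i * matrix_wrt d u X i j * t j"
proof -
  interpret X: Vector_Spaces.linear scale scale X by fact
  have "D' (u j) = t j *s u j" using D' ij by (simp add: eigenspace_def)
  then show ?thesis
    using u ij(1) representation_diagonal_map[OF u D ij(1)]
    by (simp add: matrix_wrt_def X.scale ordered_basis_def representation_scale)
qed

lemma matrix_wrt_commutator_diagonal:
  assumes u: "ordered_basis d u" and X: "Vector_Spaces.linear scale scale X"
    and D: "Vector_Spaces.linear scale scale D" "\<forall>i\<le>d. u i \<in> eigenspace D (t i)"
    and ij: "i \<le> d" "j \<le> d"
  shows "matrix_wrt d u (commutator D X) i j = (t i - t j) * matrix_wrt d u X i j"
    and "matrix_wrt d u (commutator X D) i j = (t j - t i) * matrix_wrt d u X i j"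
proof -
  interpret X: Vector_Spaces.linear scale scale X by fact
  have "D (u j) = t j *s u j" using D(2) ij by (simp add: eigenspace_def)
  then show "matrix_wrt d u (commutator D X) i j = (t i - t j) * matrix_wrt d u X i j"
    and "matrix_wrt d u (commutator X D) i j = (t j - t i) * matrix_wrt d u X i j"
    using u representation_diagonal_map[OF u D ij(1)]
    by (simp_all add: matrix_wrt_def commutator_def X.scale ordered_basis_def
        representation_diff representation_scale algebra_simps)
qed

section \<open>Conjugation by the square of W\<close>

lemma eigenspace_funpow_two:
  assumes "Vector_Spaces.linear scale scale X" "v \<in> eigenspace X \<mu>"
  shows "v \<in> eigenspace (X ^^ 2) (\<mu> ^ 2)"
proof -
  interpret X: Vector_Spaces.linear scale scale X by fact
  show ?thesis
    using assms(2) by (simp add: eigenspace_def X.scale power2_eq_square numeral_2_eq_2)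
qed

lemma linear_funpow_two:
  assumes "Vector_Spaces.linear scale scale X"
  shows "Vector_Spaces.linear scale scale (X ^^ 2)"
  using assms by (simp add: numeral_2_eq_2 linear_iff)

lemma linear_inv:
  assumes X: "Vector_Spaces.linear scale scale X" and "bij X"
  shows "Vector_Spaces.linear scale scale (inv X)"
proof -
  interpret X: Vector_Spaces.linear scale scale X by fact
  have "inv X (v + w) = inv X v + inv X w" and "inv X (k *s v) = k *s inv X v" for v w k
    using \<open>bij X\<close> by (auto intro!: inv_f_eq simp: X.add X.scale bij_is_inj bij_is_surj surj_f_inv_f)
  then show ?thesis
    using vector_space_axioms by (simp add: linear_iff)
qed

lemma eigenspace_inv:
  assumes X: "Vector_Spaces.linear scale scale X" "bij X"
    and v: "v \<in> eigenspace X \<mu>" "\<mu> \<noteq> 0"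
  shows "v \<in> eigenspace (inv X) (inverse \<mu>)"
proof -
  interpret X: Vector_Spaces.linear scale scale X by fact
  have "X (inverse \<mu> *s v) = v" using v by (simp add: eigenspace_def X.scale)
  then show ?thesis
    using X(2) by (auto simp: eigenspace_def intro!: inv_f_eq bij_is_inj)
qed

lemma W_map_diagonal:
  assumes A: "Vector_Spaces.linear scale scale A"
    and std: "standard_ordering d (huang_theta q d a) A B C"
    and u: "\<forall>i\<le>d. u i \<in> eigenspace A (huang_theta q d a i)"
  shows "Vector_Spaces.linear scale scale (W_map q a d A)"
    and "\<forall>i\<le>d. u i \<in> eigenspace (W_map q a d A) (W_weight q a d i)"
proof -
  let ?E = "\<lambda>i. primitive_idempotent A (huang_theta q d a i)"
  have E: "is_primitive_idempotent A (huang_theta q d a i) (?E i)" if "i \<le> d" for i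
    using is_primitive_idempotent_primitive_idempotent[OF A std that] .
  have lin: "?E i (v + w) = ?E i v + ?E i w" "?E i (k *s v) = k *s ?E i v" if "i \<le> d" for i v w k
    using E[OF that] by (simp_all add: is_primitive_idempotent_def linear_iff)
  show "Vector_Spaces.linear scale scale (W_map q a d A)"
    using vector_space_axioms
    by (simp add: linear_iff W_map_def lin scale_right_distrib sum.distrib scale_sum_right
        mult.commute)
  show "\<forall>i\<le>d. u i \<in> eigenspace (W_map q a d A) (W_weight q a d i)"
  proof (intro allI impI)
    fix j assume j: "j \<le> d"
    have inj: "inj_on (huang_theta q d a) {..d}"
      using std by (simp add: standard_ordering_def bij_betw_def)
    have "?E i (u j) = (if i = j then u j else 0)" if "i \<le> d" for i
    proof (cases "i = j")
      case True
      then show ?thesis using E[OF that] u j by (simp add: is_primitive_idempotent_def)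
    next
      case False
      then have "huang_theta q d a j \<noteq> huang_theta q d a i"
        using inj that j by (auto simp: inj_on_def)
      then show ?thesis
        using E[OF that] u j False unfolding is_primitive_idempotent_def by auto
    qed
    then have "W_map q a d A (u j)
        = (\<Sum>i\<le>d. if i = j then W_weight q a d j *s u j else 0)"
      unfolding W_map_def by (intro sum.cong) (auto simp: W_weight_def)
    then show "u j \<in> eigenspace (W_map q a d A) (W_weight q a d j)"
      using j by (simp add: eigenspace_def)
  qed
qed

text \<open>
  The relation determines the off-diagonal part of \<open>C\<close> from that of \<open>B\<close>, since the multiple of
  the identity on its right-hand side contributes to the diagonal only.
\<close>

lemma askey_wilson_off_diagonal:
  assumes u: "ordered_basis d u" "\<forall>i\<le>d. u i \<in> eigenspace A (\<theta> i)"
    and A: "Vector_Spaces.linear scale scale A" and B: "Vector_Spaces.linear scale scale B"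
    and rel: "askey_wilson_relation q \<alpha> C A B"
    and ij: "i \<le> d" "j \<le> d" "i \<noteq> j"
  shows "matrix_wrt d u C i j
    = - (q * \<theta> i - inverse q * \<theta> j) / (q ^ 2 - inverse q ^ 2) * matrix_wrt d u B i j"
proof -
  interpret B: Vector_Spaces.linear scale scale B by fact
  let ?r = "\<lambda>v. representation (u ` {..d}) v (u i)"
  have basis: "independent (u ` {..d})" "span (u ` {..d}) = UNIV" "inj_on u {..d}"
    using u by (auto simp: ordered_basis_def)
  have "A (u j) = \<theta> j *s u j" using u(2) ij by (simp add: eigenspace_def)
  then have "?r (C (u j) + (1 / (q ^ 2 - inverse q ^ 2)) *s
        (q *s A (B (u j)) - inverse q *s B (A (u j))))
      = ?r (C (u j)) + 1 / (q ^ 2 - inverse q ^ 2) *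
        (q * (\<theta> i * ?r (B (u j))) - inverse q * (\<theta> j * ?r (B (u j))))"
    using basis representation_diagonal_map[OF u(1) A u(2) ij(1)]
    by (simp add: representation_add representation_scale representation_diff B.scale)
  moreover have "?r (\<alpha> *s u j) = 0"
    using basis ij by (auto simp: representation_scale representation_basis inj_on_def)
  ultimately have "?r (C (u j)) + 1 / (q ^ 2 - inverse q ^ 2) *
        (q * (\<theta> i * ?r (B (u j))) - inverse q * (\<theta> j * ?r (B (u j)))) = 0"
    using rel unfolding askey_wilson_relation_def by metis
  then show ?thesis
    unfolding matrix_wrt_def by (simp add: diff_divide_distrib algebra_simps)
qed

text \<open>
  For neighbours, \<open>s = (t j / t i)\<^sup>2 = 1 / y\<^sup>2\<close> satisfies \<open>s + 1 / s = 2 + k\<^sup>2 (\<theta> i - \<theta> j)\<^sup>2\<close>.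
  Hence where conjugation by \<open>W\<^sup>2\<close> in one direction adds a multiple of one commutator, in the other
  direction it subtracts that multiple and adds \<open>k\<^sup>2\<close> times a double commutator with \<open>A\<close>.  The
  commutator that occurs for \<open>B\<close> is that of \<open>C\<close> with \<open>A\<close>, and for \<open>C\<close> that of \<open>A\<close> with \<open>B\<close>,
  because the relation makes \<open>B i j\<close> and \<open>C i j\<close> proportional.
\<close>

lemma conjugation_by_W_squared:
  fixes q a :: 'a and d :: nat and A B C :: "'b \<Rightarrow> 'b"
  defines "W \<equiv> W_map q a d A" and "k \<equiv> 1 / (q - inverse q)"
  assumes nz: "q \<noteq> 0" "q ^ 4 \<noteq> 1" "a \<noteq> 0"
    and A: "Vector_Spaces.linear scale scale A" and B: "Vector_Spaces.linear scale scale B"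
    and C: "Vector_Spaces.linear scale scale C"
    and std: "standard_ordering d (huang_theta q d a) A B C"
    and rel: "askey_wilson_relation q \<alpha> C A B"
  shows "(inv W ^^ 2) \<circ> A \<circ> (W ^^ 2) = A"
    and "(inv W ^^ 2) \<circ> B \<circ> (W ^^ 2) = (\<lambda>v. B v + k *s commutator C A v)"
    and "(inv W ^^ 2) \<circ> C \<circ> (W ^^ 2)
      = (\<lambda>v. C v - k *s commutator A B v + k ^ 2 *s commutator A (commutator A C) v)"
    and "(W ^^ 2) \<circ> A \<circ> (inv W ^^ 2) = A"
    and "(W ^^ 2) \<circ> B \<circ> (inv W ^^ 2)
      = (\<lambda>v. B v - k *s commutator C A v + k ^ 2 *s commutator A (commutator A B) v)"
    and "(W ^^ 2) \<circ> C \<circ> (inv W ^^ 2) = (\<lambda>v. C v + k *s commutator A B v)"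
proof -
  define \<theta> where "\<theta> = huang_theta q d a"
  define t where "t = W_weight q a d"
  obtain u where u: "ordered_basis d u" and eig: "\<forall>i\<le>d. u i \<in> eigenspace A (\<theta> i)"
    and tri: "tridiagonal_matrix d (matrix_wrt d u B)" "tridiagonal_matrix d (matrix_wrt d u C)"
    using std
    by (auto simp: standard_ordering_def leonard_basis_def irred_tridiagonal_matrix_def \<theta>_def)
  have t0: "t i \<noteq> 0" for i using W_weight_nonzero nz by (simp add: t_def)
  have linW: "Vector_Spaces.linear scale scale W"
    and W: "\<forall>i\<le>d. u i \<in> eigenspace W (t i)"
    using W_map_diagonal[OF A std eig[unfolded \<theta>_def]] by (simp_all add: W_def t_def)
  have bij: "bij W" unfolding W_def using bij_W_map[OF A std] nz by simp
  have linW': "Vector_Spaces.linear scale scale (inv W)" using linear_inv[OF linW bij] .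
  have W2: "\<forall>i\<le>d. u i \<in> eigenspace (W ^^ 2) (t i ^ 2)"
    using W eigenspace_funpow_two[OF linW] by blast
  have W2': "\<forall>i\<le>d. u i \<in> eigenspace (inv W ^^ 2) (inverse (t i) ^ 2)"
    using W eigenspace_funpow_two[OF linW'] eigenspace_inv[OF linW bij] t0 by blast
  note lin2 = linear_funpow_two[OF linW] linear_funpow_two[OF linW']

  let ?m = "matrix_wrt d u"
  have conj_linear:
    "Vector_Spaces.linear scale scale ((inv W ^^ 2) \<circ> X \<circ> (W ^^ 2))"
    "Vector_Spaces.linear scale scale ((W ^^ 2) \<circ> X \<circ> (inv W ^^ 2))"
    if "Vector_Spaces.linear scale scale X" for X
    using that lin2 by (simp_all add: linear_iff)
  note comm_linear = linear_commutator[OF A B] linear_commutator[OF A C] linear_commutator[OF C A]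
  note lin = conj_linear linear_combination_of_linear_maps comm_linear
    linear_commutator[OF A comm_linear(1)] linear_commutator[OF A comm_linear(2)] A B C
  note entries = matrix_wrt_linear_combination[OF u]
    matrix_wrt_commutator_diagonal[OF u _ A eig]
    matrix_wrt_diagonal_times_diagonal[OF u _ lin2(1) W2 W2']
    matrix_wrt_diagonal_times_diagonal[OF u _ lin2(2) W2' W2]
  \<comment> \<open>From \<open>q ^ 4 \<noteq> 1\<close>, neither \<open>q - 1 / q\<close> nor \<open>q\<^sup>2 - 1 / q\<^sup>2\<close> vanishes, so \<open>k\<close> is a genuine
    reciprocal and so is the factor in the relation.\<close>
  have "q ^ 2 \<noteq> 1" using nz(2) by (auto simp: power4_eq_xxxx power2_eq_square)
  then have k0: "k \<noteq> 0" using nz(1) by (simp add: k_def field_simps power2_eq_square)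
  have neighbours:
    "\<exists>y. y \<noteq> 0 \<and> \<theta> i = \<theta> j + (1 / y - y) / k \<and> t j = - t i / y \<and> ?m C i j = - ?m B i j / y"
    if ij: "i \<le> d" "j \<le> d" "j = Suc i \<or> i = Suc j" for i j
  proof -
    obtain y where y: "y \<noteq> 0" "\<theta> i = y / q + q / y" "\<theta> j = y * q + 1 / (y * q)"
        "t j = - t i / y"
      using neighbour_parameter[OF nz(1,3) ij] unfolding \<theta>_def t_def by metis
    have q2: "q ^ 2 - inverse q ^ 2 \<noteq> 0"
      using nz(1,2) by (simp add: field_simps power4_eq_xxxx power2_eq_square)
    have "\<theta> i - \<theta> j = (q - inverse q) * (1 / y - y)"
      using y(1) nz(1) by (simp add: y(2,3) field_simps)
    then have "\<theta> i = \<theta> j + (1 / y - y) / k" by (simp add: k_def algebra_simps)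
    moreover have "q * \<theta> i - inverse q * \<theta> j = (q ^ 2 - inverse q ^ 2) / y"
      using y(1) nz(1) by (simp add: y(2,3) field_simps power2_eq_square)
    then have "?m C i j = - ?m B i j / y"
      using askey_wilson_off_diagonal[OF u eig A B rel ij(1,2)] ij(3) q2 by auto
    ultimately show ?thesis using y by blast
  qed
  \<comment> \<open>Far from the diagonal both \<open>B\<close> and \<open>C\<close> vanish, and on it conjugation and commutation
    with \<open>A\<close> are trivial, so only neighbours carry a real identity.\<close>
  have position_cases [consumes 2, case_names diagonal distant neighbours]: "P"
    if "i \<le> d" "j \<le> d" "i = j \<Longrightarrow> P"
      "?m B i j = 0 \<Longrightarrow> ?m C i j = 0 \<Longrightarrow> P"
      "\<And>y. y \<noteq> 0 \<Longrightarrow> \<theta> i = \<theta> j + (1 / y - y) / k \<Longrightarrow>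
        t j = - t i / y \<Longrightarrow> ?m C i j = - ?m B i j / y \<Longrightarrow> P"
    for i j P
    using that neighbours[OF that(1,2)] tri unfolding tridiagonal_matrix_def by metis
  have A_diagonal: "?m A i j = (if i = j then \<theta> j else 0)" if "i \<le> d" "j \<le> d" for i j
    using u eig that
    by (auto simp: matrix_wrt_def ordered_basis_def eigenspace_def representation_scale
        representation_basis inj_on_def)
  show "(inv W ^^ 2) \<circ> A \<circ> (W ^^ 2) = A" "(W ^^ 2) \<circ> A \<circ> (inv W ^^ 2) = A"
    using t0
    by (auto intro!: linear_eq_if_matrix_wrt_eq[OF u] lin
        simp: entries A A_diagonal field_simps)
  show "(inv W ^^ 2) \<circ> B \<circ> (W ^^ 2) = (\<lambda>v. B v + k *s commutator C A v)"
  proof (intro linear_eq_if_matrix_wrt_eq[OF u] lin)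
    fix i j assume ij: "i \<le> d" "j \<le> d"
    show "?m ((inv W ^^ 2) \<circ> B \<circ> (W ^^ 2)) i j
        = ?m (\<lambda>v. B v + k *s commutator C A v) i j"
      using ij
    proof (cases rule: position_cases)
      case (neighbours y)
      then show ?thesis
        using t0[of i] k0 neighbours(1)
        by (simp add: entries B C comm_linear ij neighbours(2-4))
          (simp add: field_simps power2_eq_square)
    qed (simp_all add: entries B C comm_linear ij t0 field_simps)
  qed
  show "(inv W ^^ 2) \<circ> C \<circ> (W ^^ 2)
      = (\<lambda>v. C v - k *s commutator A B v + k ^ 2 *s commutator A (commutator A C) v)"
  proof (intro linear_eq_if_matrix_wrt_eq[OF u] lin)
    fix i j assume ij: "i \<le> d" "j \<le> d"
    show "?m ((inv W ^^ 2) \<circ> C \<circ> (W ^^ 2)) i j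
        = ?m (\<lambda>v. C v - k *s commutator A B v + k ^ 2 *s commutator A (commutator A C) v) i j"
      using ij
    proof (cases rule: position_cases)
      case (neighbours y)
      then show ?thesis
        using t0[of i] k0 neighbours(1)
        by (simp add: entries B C comm_linear ij neighbours(2-4))
          (simp add: field_simps power2_eq_square)
    qed (simp_all add: entries B C comm_linear ij t0 field_simps)
  qed
  show "(W ^^ 2) \<circ> B \<circ> (inv W ^^ 2)
      = (\<lambda>v. B v - k *s commutator C A v + k ^ 2 *s commutator A (commutator A B) v)"
  proof (intro linear_eq_if_matrix_wrt_eq[OF u] lin)
    fix i j assume ij: "i \<le> d" "j \<le> d"
    show "?m ((W ^^ 2) \<circ> B \<circ> (inv W ^^ 2)) i j
        = ?m (\<lambda>v. B v - k *s commutator C A v + k ^ 2 *s commutator A (commutator A B) v) i j"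
      using ij
    proof (cases rule: position_cases)
      case (neighbours y)
      then show ?thesis
        using t0[of i] k0 neighbours(1)
        by (simp add: entries B C comm_linear ij neighbours(2-4))
          (simp add: field_simps power2_eq_square)
    qed (simp_all add: entries B C comm_linear ij t0 field_simps)
  qed
  show "(W ^^ 2) \<circ> C \<circ> (inv W ^^ 2) = (\<lambda>v. C v + k *s commutator A B v)"
  proof (intro linear_eq_if_matrix_wrt_eq[OF u] lin)
    fix i j assume ij: "i \<le> d" "j \<le> d"
    show "?m ((W ^^ 2) \<circ> C \<circ> (inv W ^^ 2)) i j
        = ?m (\<lambda>v. C v + k *s commutator A B v) i j"
      using ij
    proof (cases rule: position_cases)
      case (neighbours y)
      then show ?thesis
        using t0[of i] k0 neighbours(1)
        by (simp add: entries B C comm_linear ij neighbours(2-4))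
          (simp add: field_simps power2_eq_square)
    qed (simp_all add: entries B C comm_linear ij t0 field_simps)
  qed
qed

end

section \<open>Cyclic symmetry\<close>

theorem proposition10p3:
  fixes scale :: "'a::field \<Rightarrow> 'v::ab_group_add \<Rightarrow> 'v"
    and d :: nat and q a b c :: 'a
    and A B C W W' W'' :: "'v \<Rightarrow> 'v"
  assumes V: "vector_space scale" "vector_space.dim scale (UNIV :: 'v set) = d + 1"
    and params: "huang_parameters q a b c d"
    and triple: "vector_space.q_racah_leonard_triple scale q a b c d A B C"
    and W: "W = vector_space.W_map scale q a d A"
    and W': "W' = vector_space.W_map scale q b d B"
    and W'': "W'' = vector_space.W_map scale q c d C"
  shows
     "((inv W ^^ 2) \<circ> A \<circ> (W ^^ 2) = A) \<and>
      ((inv W ^^ 2) \<circ> B \<circ> (W ^^ 2) = (\<lambda>v. B v + scale (1 / (q - inverse q)) (commutator C A v))) \<and>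
      ((inv W ^^ 2) \<circ> C \<circ> (W ^^ 2) = (\<lambda>v. C v - scale (1 / (q - inverse q)) (commutator A B v)
           + scale (1 / (q - inverse q) ^ 2) (commutator A (commutator A C) v))) \<and>

      ((W ^^ 2) \<circ> A \<circ> (inv W ^^ 2) = A) \<and>
      ((W ^^ 2) \<circ> B \<circ> (inv W ^^ 2) = (\<lambda>v. B v - scale (1 / (q - inverse q)) (commutator C A v)
           + scale (1 / (q - inverse q) ^ 2) (commutator A (commutator A B) v))) \<and>
      ((W ^^ 2) \<circ> C \<circ> (inv W ^^ 2) = (\<lambda>v. C v + scale (1 / (q - inverse q)) (commutator A B v))) \<and>

      ((inv W' ^^ 2) \<circ> A \<circ> (W' ^^ 2) = (\<lambda>v. A v - scale (1 / (q - inverse q)) (commutator B C v)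
           + scale (1 / (q - inverse q) ^ 2) (commutator B (commutator B A) v))) \<and>
      ((inv W' ^^ 2) \<circ> B \<circ> (W' ^^ 2) = B) \<and>
      ((inv W' ^^ 2) \<circ> C \<circ> (W' ^^ 2) = (\<lambda>v. C v + scale (1 / (q - inverse q)) (commutator A B v))) \<and>

      ((W' ^^ 2) \<circ> A \<circ> (inv W' ^^ 2) = (\<lambda>v. A v + scale (1 / (q - inverse q)) (commutator B C v))) \<and>
      ((W' ^^ 2) \<circ> B \<circ> (inv W' ^^ 2) = B) \<and>
      ((W' ^^ 2) \<circ> C \<circ> (inv W' ^^ 2) = (\<lambda>v. C v - scale (1 / (q - inverse q)) (commutator A B v)
           + scale (1 / (q - inverse q) ^ 2) (commutator B (commutator B C) v))) \<and>

      ((inv W'' ^^ 2) \<circ> A \<circ> (W'' ^^ 2) = (\<lambda>v. A v + scale (1 / (q - inverse q)) (commutator B C v))) \<and>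
      ((inv W'' ^^ 2) \<circ> B \<circ> (W'' ^^ 2) = (\<lambda>v. B v - scale (1 / (q - inverse q)) (commutator C A v)
           + scale (1 / (q - inverse q) ^ 2) (commutator C (commutator C B) v))) \<and>
      ((inv W'' ^^ 2) \<circ> C \<circ> (W'' ^^ 2) = C) \<and>

      ((W'' ^^ 2) \<circ> A \<circ> (inv W'' ^^ 2) = (\<lambda>v. A v - scale (1 / (q - inverse q)) (commutator B C v)
           + scale (1 / (q - inverse q) ^ 2) (commutator C (commutator C A) v))) \<and>
      ((W'' ^^ 2) \<circ> B \<circ> (inv W'' ^^ 2) = (\<lambda>v. B v + scale (1 / (q - inverse q)) (commutator C A v))) \<and>
      ((W'' ^^ 2) \<circ> C \<circ> (inv W'' ^^ 2) = C)"
proof -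
  interpret vector_space scale by (rule V(1))
  have nz: "q \<noteq> 0" "q ^ 4 \<noteq> 1" "a \<noteq> 0" "b \<noteq> 0" "c \<noteq> 0"
    using params by (auto simp: huang_parameters_def)
  have lin: "Vector_Spaces.linear scale scale A" "Vector_Spaces.linear scale scale B"
    "Vector_Spaces.linear scale scale C"
    and std: "standard_ordering d (huang_theta q d a) A B C"
    "standard_ordering d (huang_theta q d b) B C A"
    "standard_ordering d (huang_theta q d c) C A B"
    and rel: "askey_wilson_relation q (huang_alpha q d a b c) A B C"
    "askey_wilson_relation q (huang_alpha q d b c a) B C A"
    "askey_wilson_relation q (huang_alpha q d c a b) C A B"
    using triple by (auto simp: q_racah_leonard_triple_def leonard_triple_def)
  show ?thesis
    using conjugation_by_W_squared[OF nz(1,2,3) lin(1,2,3) std(1) rel(3), folded W]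
      conjugation_by_W_squared[OF nz(1,2,4) lin(2,3,1) std(2) rel(1), folded W']
      conjugation_by_W_squared[OF nz(1,2,5) lin(3,1,2) std(3) rel(2), folded W'']
    unfolding power_one_over by (intro conjI)
qed

end
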